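(* Let $d, n \ge 1$ be integers, and let $U_1, \ldots, U_n \subset \mathbb{R}^d$ be finite sets of vectors with $0 \in \operatorname{conv} U_i$ for each $i \in \{1,\ldots,n\}$. Then for any vectors $x_1, \ldots, x_n \in \mathbb{R}^d$ one may select $u_i \in U_i$ for each $i \in \{1,\ldots,n\}$ so that, setting $u = \sum_{i=1}^n u_i$, $$\langle u - x_k, u_k \rangle \ge |u_k|^2$$ holds for every $k \in \{1,\ldots,n\}$.
   Context: $\langle \cdot,\cdot\rangle$ is the standard inner product on $\mathbb{R}^d$, $|\cdot|$ the Euclidean norm, and $\operatorname{conv}$ denotes convex hull. *)

theory Defs
  imports "HOL-Analysis.Analysis"
begin

end

theory Submission
  imports Defs
begin

text \<open>
  Choose the selection that maximises the energy
  \<open>\<Sum>i<j. u i \<bullet> u j - \<Sum>i. x i \<bullet> u i\<close>, which is affine in each \<open>u k\<close> separately, with slope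
  \<open>a = \<Sum>i\<noteq>k. u i - x k\<close>. By maximality \<open>U k\<close>, hence its convex hull, lies in the half-space
  \<open>a \<bullet> v \<le> a \<bullet> u k\<close>; as 0 is in the hull, \<open>0 \<le> a \<bullet> u k\<close>.
\<close>

lemma inner_nonneg_if_maximal:
  fixes a w :: "'a :: real_inner"
  assumes "0 \<in> convex hull S" and "\<And>v. v \<in> S \<Longrightarrow> a \<bullet> v \<le> a \<bullet> w"
  shows "0 \<le> a \<bullet> w"
proof -
  have "convex hull S \<subseteq> {v. a \<bullet> v \<le> a \<bullet> w}"
    using assms(2) by (intro hull_minimal) (auto simp: convex_halfspace_le)
  with assms(1) show ?thesis by auto
qed

text \<open>The pair interactions are written as \<open>((norm (\<Sum>i. u i))\<^sup>2 - \<Sum>i. (norm (u i))\<^sup>2) / 2\<close>.\<close>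

definition energy :: "'i set \<Rightarrow> ('i \<Rightarrow> 'a :: real_inner) \<Rightarrow> ('i \<Rightarrow> 'a) \<Rightarrow> real" where
  "energy I x u = (sum u I \<bullet> sum u I - (\<Sum>i\<in>I. u i \<bullet> u i)) / 2 - (\<Sum>i\<in>I. x i \<bullet> u i)"

text \<open>With \<open>s\<close> the sum of \<open>u i\<close> over \<open>i \<noteq> k\<close>,
  the square \<open>v \<bullet> v\<close> cancels between \<open>(s + v) \<bullet> (s + v)\<close>
  and the subtracted squares; what depends on \<open>v\<close> is
  \<open>s \<bullet> v - x k \<bullet> v\<close>.\<close>

lemma energy_fun_upd:
  assumes "finite I" and "k \<in> I"
  shows "energy I x (u(k := v)) - energy I x u = (sum u I - u k - x k) \<bullet> v - (sum u I - u k - x k) \<bullet> u k"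
proof -
  have upd: "(\<Sum>i\<in>I - {k}. g i ((u(k := v)) i)) = (\<Sum>i\<in>I - {k}. g i (u i))"
    for g :: "_ \<Rightarrow> _ \<Rightarrow> 'c :: comm_monoid_add"
    by (rule sum.cong) auto
  have sum_upd: "sum (u(k := v)) (I - {k}) = sum u (I - {k})"
    using upd[of "\<lambda>_ z. z"] by simp
  show ?thesis
    unfolding energy_def sum.remove[OF assms] sum_upd
      upd[of "\<lambda>_ z. z \<bullet> z"] upd[of "\<lambda>i z. x i \<bullet> z"]
    using inner_commute[of v "sum u (I - {k})"] inner_commute[of "u k" "sum u (I - {k})"]
    by (simp add: inner_add_left inner_add_right inner_diff_left field_simps)
qed

theorem corollary1:
  fixes n :: nat
    and U :: "nat \<Rightarrow> (real ^ 'd) set"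
    and x :: "nat \<Rightarrow> real ^ 'd"
  assumes "n \<ge> 1"
    and "\<And>i. i \<in> {1..n} \<Longrightarrow> finite (U i)"
    and "\<And>i. i \<in> {1..n} \<Longrightarrow> 0 \<in> convex hull (U i)"
  shows "\<exists>u :: nat \<Rightarrow> real ^ 'd.
    (\<forall>i\<in>{1..n}. u i \<in> U i) \<and>
    (\<forall>k\<in>{1..n}. ((\<Sum>i=1..n. u i) - x k) \<bullet> u k \<ge> (norm (u k))\<^sup>2)"
proof -
  \<comment> \<open>Extensional functions make the set of selections finite, so a maximiser
    exists.\<close>
  let ?P = "PiE {1..n} U"
  have "finite ?P" using assms(2) by (intro finite_PiE) auto
  moreover have "?P \<noteq> {}" using assms(3) by (fastforce simp: PiE_eq_empty_iff)
  ultimately obtain u where u: "u \<in> ?P"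
    and max: "\<And>w. w \<in> ?P \<Longrightarrow> energy {1..n} x w \<le> energy {1..n} x u"
    using ex_is_arg_min_if_finite[of ?P "\<lambda>w. - energy {1..n} x w"] by (auto simp: is_arg_min_linorder)
  have "((\<Sum>i=1..n. u i) - x k) \<bullet> u k \<ge> (norm (u k))\<^sup>2" if k: "k \<in> {1..n}" for k
  proof -
    let ?a = "sum u {1..n} - u k - x k"
    have "?a \<bullet> v \<le> ?a \<bullet> u k" if "v \<in> U k" for v
    proof -
      have "u(k := v) \<in> ?P" using u k that by (auto simp: PiE_iff extensional_def)
      from max[OF this] show ?thesis using energy_fun_upd[of "{1..n}" k x u v] k by simp
    qed
    with assms(3)[OF k] have "0 \<le> ?a \<bullet> u k" by (rule inner_nonneg_if_maximal)
    \<comment> \<open>The summand \<open>- u k\<close> of \<open>?a\<close> contributes the term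
      \<open>(norm (u k))\<^sup>2\<close>.\<close>
    then show ?thesis by (simp add: power2_norm_eq_inner inner_diff_left)
  qed
  with u show ?thesis by (auto simp: PiE_iff)
qed

end
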